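(* Let $\mathbf{R}=\{r_1,\dots,r_n\}$ be a finite set of decision procedures, where $r_i$ has runtime $t_i$ and quality $q_i$, and let $t_d$ be a known deadline such that at least one $r_i\in\mathbf{R}$ has $t_i\le t_d$. Let $r^*\in\arg\max_{r_i\in\mathbf{R},\,t_i\le t_d} q_i$. Then the one-element sequence consisting of $r^*$ is a bounded optimal program for the episodic task environment with fixed deadline $t_d$; that is, $V(r^* )\ge V(s)$ for every agent program $s$ over $\mathbf{R}$, where $V$ is the fixed-deadline value.
   Context: Each decision procedure (rule) $r_i\in\mathbf{R}$ has an integer runtime $t_i\ge 0$ and a real quality $q_i\ge 0$; it recommends an action, and $q_i$ is the expected utility of executing that action in an episode. An agent program is a finite nonempty sequence $s=s_1\ldots s_m$ of elements of $\mathbf{R}$, and the architecture runs $s_1,\dots,s_m$ in order. Write $t_{s_i},q_{s_i}$ for the runtime and quality of $s_i$. Fixed deadline $t_d$: acting at any time up to $t_d$ yields the same utility, and actions after $t_d$ have no effect. At the deadline (or on completing the sequence, if earlier) the agent executes the action recommended by the highest-quality rule completed so far. Hence the value of the program is $V(s)=\max\{q_{s_1},\dots,q_{s_j}\}$, where $s_1\ldots s_j$ is the longest prefix of $s$ with $\sum_{i=1}^{j}t_{s_i}\le t_d$ (and $V(s)=0$ if this prefix is empty). A program is bounded optimal if it maximizes $V$ among all agent programs over $\mathbf{R}$. *)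

theory Defs
  imports Complex_Main
begin

text \<open>
  Decision procedures are elements of an arbitrary type \<open>'r\<close>, with their runtimes and
  qualities given by functions \<open>t\<close> and \<open>q\<close>; distinct procedures may thus share
  both runtime and quality. Runtimes are nonnegative integers; the deadline may be any real.
\<close>

definition agent_program :: "'r set \<Rightarrow> 'r list \<Rightarrow> bool" where
  "agent_program R s \<longleftrightarrow> s \<noteq> [] \<and> set s \<subseteq> R"

text \<open>
  The longest prefix that fits before the deadline. For \<open>td < 0\<close> not even the empty
  prefix fits, and the result is unspecified.
\<close>

definition completed :: "('r \<Rightarrow> nat) \<Rightarrow> real \<Rightarrow> 'r list \<Rightarrow> 'r list" where
  "completed t td s =
     take (GREATEST j. j \<le> length s \<and> real (\<Sum>r\<leftarrow>take j s. t r) \<le> td) s"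

definition fixed_deadline_value ::
  "('r \<Rightarrow> nat) \<Rightarrow> ('r \<Rightarrow> real) \<Rightarrow> real \<Rightarrow> 'r list \<Rightarrow> real" where
  "fixed_deadline_value t q td s =
     (if completed t td s = [] then 0 else Max (q ` set (completed t td s)))"

definition bounded_optimal :: "'r set \<Rightarrow> ('r list \<Rightarrow> real) \<Rightarrow> 'r list \<Rightarrow> bool" where
  "bounded_optimal R V s \<longleftrightarrow>
     agent_program R s \<and> (\<forall>s'. agent_program R s' \<longrightarrow> V s' \<le> V s)"

end

theory Submission
  imports Defs
begin

text \<open>Runtimes are nonnegative, so a rule completed within a program takes no longer than the
  whole completed prefix and would meet the deadline alone
  (\<open>runtime_le_deadline_if_completed\<close>). Every completed rule therefore competes in the
  argmax defining \<open>rstar\<close>, and a maximum over such rules is at most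
  \<open>q rstar\<close>. The program \<open>[rstar]\<close> attains this bound, because it runs to
  completion (\<open>completed_eq_self\<close>).\<close>

lemma completed_fits:
  assumes "0 \<le> td"
  shows "real (\<Sum>r\<leftarrow>completed t td s. t r) \<le> td"
proof -
  let ?P = "\<lambda>j. j \<le> length s \<and> real (\<Sum>r\<leftarrow>take j s. t r) \<le> td"
  have "?P (Greatest ?P)"
    \<comment> \<open>The empty prefix, of total runtime 0, is the witness; \<open>length s\<close>
      bounds the candidates, so a greatest one exists.\<close>
    by (rule GreatestI_nat[where k = 0 and b = "length s"]) (use assms in auto)
  then show ?thesis
    by (simp add: completed_def)
qed

lemma set_completed_subset: "set (completed t td s) \<subseteq> set s"
  by (simp add: completed_def set_take_subset)

lemma runtime_le_deadline_if_completed: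
  assumes "0 \<le> td" "r \<in> set (completed t td s)"
  shows "real (t r) \<le> td"
proof -
  have "t r \<le> (\<Sum>r\<leftarrow>completed t td s. t r)"
    using assms(2) by (intro member_le_sum_list) auto
  then show ?thesis
    using completed_fits[OF assms(1), of t s] by linarith
qed

text \<open>The full length is itself admissible, and no larger index is allowed.\<close>

lemma completed_eq_self:
  assumes "real (\<Sum>r\<leftarrow>s. t r) \<le> td"
  shows "completed t td s = s"
proof -
  have "(GREATEST j. j \<le> length s \<and> real (\<Sum>r\<leftarrow>take j s. t r) \<le> td) = length s"
    by (rule Greatest_equality) (use assms in auto)
  then show ?thesis
    by (simp add: completed_def)
qed

theorem theorem1:
  fixes R :: "'r set"
    and t :: "'r \<Rightarrow> nat"
    and q :: "'r \<Rightarrow> real"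
    and td :: real
    and rstar :: 'r
  assumes "finite R"
    and "\<forall>r\<in>R. 0 \<le> q r"
    and "\<exists>r\<in>R. real (t r) \<le> td"
    and "is_arg_max q (\<lambda>r. r \<in> R \<and> real (t r) \<le> td) rstar"
  shows "bounded_optimal R (fixed_deadline_value t q td) [rstar]"
proof -
  have rstar: "rstar \<in> R" "real (t rstar) \<le> td"
    using assms(4) by (auto simp: is_arg_max_linorder)
  have best: "q r \<le> q rstar" if "r \<in> R" "real (t r) \<le> td" for r
    using assms(4) that by (auto simp: is_arg_max_linorder)
  \<comment> \<open>Runtimes are natural numbers, so the one of \<open>rstar\<close> forces this; it
    ensures that \<open>completed\<close> is well specified for every program.\<close>
  have "0 \<le> td"
    using rstar(2) by linarith
  have value_rstar: "fixed_deadline_value t q td [rstar] = q rstar"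
    using rstar(2) by (simp add: fixed_deadline_value_def completed_eq_self)
  have "fixed_deadline_value t q td s \<le> q rstar" if "agent_program R s" for s
  proof (cases "completed t td s = []")
    \<comment> \<open>The value defaults to 0 here, so nonnegativity of \<open>q rstar\<close> is
      what counts.\<close>
    case True
    then show ?thesis
      using assms(2) rstar(1) by (simp add: fixed_deadline_value_def)
  next
    case False
    have "q r \<le> q rstar" if "r \<in> set (completed t td s)" for r
      using that \<open>agent_program R s\<close> set_completed_subset[of t td s]
        runtime_le_deadline_if_completed[OF \<open>0 \<le> td\<close> that]
      by (intro best) (auto simp: agent_program_def)
    \<comment> \<open>\<open>Max\<close> ranges over a finite nonempty set, so the pointwise bound
      suffices.\<close>
    with False show ?thesis
      by (simp add: fixed_deadline_value_def)
  qed
  with rstar(1) show ?thesis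
    by (simp add: bounded_optimal_def agent_program_def value_rstar)
qed

end
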